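(* Let $p>1$ and $1<q\le\frac{2p}{p+1}$, and let $U_h$ be the positive solution of the semidiscrete problem $$\frac{du_j}{dt}(t)-\delta_x^2u_j(t)+b_j|\delta_xu_j(t)|^q=|u_j(t)|^p\ (1\le j\le N),\quad u_j(0)=u_j^0\ge 0\ (1\le j\le N),\quad u_0(t)=u_{N+1}(t)=0.$$ If $q<\frac{2p}{p+1}$, choose a large initial data. If $q=\frac{2p}{p+1}$, choose $0<b_\infty<\frac{p-1}{2}\left(\frac{2}{p+1}\right)^{1/(p+1)}$. Suppose also that $U_h$ blows up in finite time $T_h^*$. Then there exist two positive constants $C_1$ and $C_2$ such that $$C_1(T_h^*-t)^{-\frac1{p-1}}\le\max_{1\le j\le N}u_j(t)\le C_2(T_h^*-t)^{-\frac1{p-1}}\quad\text{for all }t\in(0,T_h^* ).$$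
   Context: $b$ is a continuous, positive and bounded function, $b_\infty=\|b\|_\infty$, and $b_j$ is the approximation of $b(x_j)$. For the mesh size $h>0$, $N=E(2/h)+1$, where $E(X)$ is the integer part of $X$, and $x_j=-1+jh$ for $0\le j\le N+1$. The unknown is $U_h(t)=(u_0(t),\dots,u_{N+1}(t))'$. Difference operators: $\delta_x^2u_j=\frac{u_{j+1}-2u_j+u_{j-1}}{h^2}$, $\delta_xu_j=\frac{u_{j+1}-u_{j-1}}{2h}$. Norm: $\|U_h(t)\|_\infty=\max_{0\le j\le N+1}|u_j(t)|$. $(0,T_h^* )$ is the maximal time interval on which $\|U_h(t)\|_\infty<\infty$; blow-up in finite time $T_h^*$ means $T_h^*<\infty$ and $\lim_{t\to T_h^*}\|U_h(t)\|_\infty=\infty$. Standing mesh convention: with $T_h<T_h^*$, $h_0>0$ sufficiently small and $M_{T_h}=\max_{0\le t\le T_h,\,0\le j\le N+1}|u_j(t)|$, the mesh size is $h=\min\left(h_0,\left(\frac{2}{b_\infty q}M_{T_h}^{1-q}\right)^{1/(2-q)}\right)$. The paper's statement does not quantify "large initial data". *)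

theory Defs
  imports "HOL-Analysis.Analysis"
begin

text \<open>A grid function is a map \<open>v :: nat \<Rightarrow> real\<close>, only read at the indices \<open>0, \<dots>, N + 1\<close>;
  \<open>u t j\<close> stands for \<open>u\<^sub>j(t)\<close>.\<close>

definition mesh_N :: "real \<Rightarrow> nat" where
  "mesh_N h = nat \<lfloor>2 / h\<rfloor> + 1"

definition second_diff :: "real \<Rightarrow> (nat \<Rightarrow> real) \<Rightarrow> nat \<Rightarrow> real" where
  "second_diff h v j = (v (j + 1) - 2 * v j + v (j - 1)) / h\<^sup>2"

definition central_diff :: "real \<Rightarrow> (nat \<Rightarrow> real) \<Rightarrow> nat \<Rightarrow> real" where
  "central_diff h v j = (v (j + 1) - v (j - 1)) / (2 * h)"

definition grid_norm :: "real \<Rightarrow> (nat \<Rightarrow> real) \<Rightarrow> real" where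
  "grid_norm h v = Max ((\<lambda>j. \<bar>v j\<bar>) ` {0..mesh_N h + 1})"

definition sup_norm :: "(real \<Rightarrow> real) \<Rightarrow> real" where
  "sup_norm b = (SUP x. \<bar>b x\<bar>)"

text \<open>The scheme by which \<open>\<beta> j\<close> approximates \<open>b (- 1 + j h)\<close> is left open: the approximate
  coefficients are only required to be positive and, like \<open>b\<close> itself, bounded by \<open>\<parallel>b\<parallel>\<^sub>\<infinity>\<close>.
  The nodal values \<open>\<beta> j = b (- 1 + j h)\<close> and local averages of \<open>b\<close> are instances.
  Since \<open>-1 + N h > 1\<close>, the coefficient \<open>b\<close> is taken as a function on the whole line.\<close>

definition approx_coeff :: "(real \<Rightarrow> real) \<Rightarrow> real \<Rightarrow> (nat \<Rightarrow> real) \<Rightarrow> bool" where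
  "approx_coeff b h \<beta> \<longleftrightarrow> (\<forall>j\<in>{1..mesh_N h}. 0 < \<beta> j \<and> \<beta> j \<le> sup_norm b)"

text \<open>Solution on \<open>[0, T)\<close>; at \<open>t = 0\<close> the derivative is one-sided.\<close>

definition semidiscrete_solution ::
  "real \<Rightarrow> real \<Rightarrow> real \<Rightarrow> (nat \<Rightarrow> real) \<Rightarrow> (nat \<Rightarrow> real) \<Rightarrow> real \<Rightarrow> (real \<Rightarrow> nat \<Rightarrow> real) \<Rightarrow> bool"
where
  "semidiscrete_solution p q h \<beta> u0 T u \<longleftrightarrow>
     (\<forall>t\<in>{0..<T}. \<forall>j\<in>{1..mesh_N h}.
        ((\<lambda>s. u s j) has_real_derivative
           (second_diff h (u t) j - \<beta> j * \<bar>central_diff h (u t) j\<bar> powr q + \<bar>u t j\<bar> powr p))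
        (at t within {0..<T})) \<and>
     (\<forall>j\<in>{1..mesh_N h}. u 0 j = u0 j) \<and>
     (\<forall>t\<in>{0..<T}. u t 0 = 0 \<and> u t (mesh_N h + 1) = 0)"

definition maximal_solution ::
  "real \<Rightarrow> real \<Rightarrow> real \<Rightarrow> (nat \<Rightarrow> real) \<Rightarrow> (nat \<Rightarrow> real) \<Rightarrow> real \<Rightarrow> (real \<Rightarrow> nat \<Rightarrow> real) \<Rightarrow> bool"
where
  "maximal_solution p q h \<beta> u0 T u \<longleftrightarrow>
     semidiscrete_solution p q h \<beta> u0 T u \<and>
     \<not> (\<exists>T'>T. \<exists>v. semidiscrete_solution p q h \<beta> u0 T' v \<and>
            (\<forall>t\<in>{0..<T}. \<forall>j\<le>mesh_N h + 1. v t j = u t j))"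

definition positive_on :: "real \<Rightarrow> real \<Rightarrow> (real \<Rightarrow> nat \<Rightarrow> real) \<Rightarrow> bool" where
  "positive_on h T u \<longleftrightarrow> (\<forall>t\<in>{0<..<T}. \<forall>j\<in>{1..mesh_N h}. 0 < u t j)"

text \<open>Finiteness of the blow-up time is expressed by \<open>T :: real\<close>.\<close>

definition blows_up_at :: "real \<Rightarrow> real \<Rightarrow> (real \<Rightarrow> nat \<Rightarrow> real) \<Rightarrow> bool" where
  "blows_up_at h T u \<longleftrightarrow> filterlim (\<lambda>t. grid_norm h (u t)) at_top (at_left T)"

text \<open>The supremum below is the maximum over \<open>0 \<le> t \<le> Th\<close> and \<open>0 \<le> j \<le> N + 1\<close>; it is attained
  for a solution on \<open>[0, T)\<close> with \<open>Th < T\<close>, by continuity. As it depends on the solution, which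
  lives on the mesh of size \<open>h\<close>, the mesh convention is an implicit relation between \<open>h\<close> and \<open>u\<close>.\<close>

definition max_upto :: "real \<Rightarrow> real \<Rightarrow> (real \<Rightarrow> nat \<Rightarrow> real) \<Rightarrow> real" where
  "max_upto h Th u = (SUP t\<in>{0..Th}. grid_norm h (u t))"

definition mesh_convention ::
  "real \<Rightarrow> real \<Rightarrow> real \<Rightarrow> real \<Rightarrow> real \<Rightarrow> (real \<Rightarrow> nat \<Rightarrow> real) \<Rightarrow> bool"
where
  "mesh_convention q binf h0 h Th u \<longleftrightarrow>
     h = min h0 ((2 / (binf * q) * max_upto h Th u powr (1 - q)) powr (1 / (2 - q)))"

end

theory Submission
  imports Defs
begin

text \<open>Let \<open>M\<close> be the maximum of the nodal values. At a node where it is attained the second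
  difference is nonpositive, so \<open>M' \<le> M\<^sup>p\<close>. There also \<open>\<delta>\<^sub>x\<^sup>2 u\<^sub>j \<ge> - 2 M / h\<^sup>2\<close> and
  \<open>\<bar>\<delta>\<^sub>x u\<^sub>j\<bar> \<le> M / (2 h)\<close>; as \<open>1, q < p\<close>, for a fixed mesh both terms are absorbed by \<open>M\<^sup>p\<close> once
  \<open>M\<close> is large, so \<open>M' \<ge> M\<^sup>p / 2\<close> near the blow-up time. Integrating both inequalities for
  \<open>M\<^bsup>1-p\<^esup>\<close>, which tends to \<open>0\<close> at \<open>T\<close>, gives the two rates. The second one extends
  back to \<open>t = 0\<close> by compactness, as the constants may depend on the mesh and on the solution.\<close>

section \<open>Growth of the maximum of finitely many differentiable functions\<close>

lemma obtains_maximizer: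
  fixes f :: "'a \<Rightarrow> 'b::linorder"
  assumes "finite J" "J \<noteq> {}"
  obtains j where "j \<in> J" "Max (f ` J) = f j" "\<And>k. k \<in> J \<Longrightarrow> f k \<le> f j"
proof -
  have "Max (f ` J) \<in> f ` J" using assms by (intro Max_in) auto
  then obtain j where j: "Max (f ` J) = f j" "j \<in> J" by (rule imageE)
  moreover have "f k \<le> Max (f ` J)" if "k \<in> J" for k using assms that by (intro Max_ge) auto
  ultimately show thesis by (intro that[of j]) auto
qed

text \<open>A maximum of smooth functions need not be differentiable, so a continuation argument
  replaces its derivative. At the last time where some \<open>f j\<close> reaches the line of slope
  \<open>c\<close> through \<open>f i a\<close>, the maximizing function reaches it too and is
  steeper, so that time cannot precede \<open>b\<close>.\<close>

lemma maximum_grows_strict: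
  fixes f D :: "'a \<Rightarrow> real \<Rightarrow> real"
  assumes J: "finite J" "i \<in> J" and ab: "a \<le> b"
    and deriv: "\<And>j t. j \<in> J \<Longrightarrow> t \<in> {a..b} \<Longrightarrow> (f j has_real_derivative D j t) (at t)"
    and D: "\<And>j t. j \<in> J \<Longrightarrow> t \<in> {a..b} \<Longrightarrow> (\<And>k. k \<in> J \<Longrightarrow> f k t \<le> f j t) \<Longrightarrow> c < D j t"
  shows "\<exists>j\<in>J. f i a + c * (b - a) \<le> f j b"
proof -
  \<comment> \<open>Written as a finite union over \<open>j\<close>, so that closedness follows from
    continuity of each \<open>f j\<close> alone.\<close>
  define S where "S = (\<Union>j\<in>J. {t \<in> {a..b}. f i a + c * (t - a) \<le> f j t})"
  have cont: "continuous_on {a..b} (f j)" if "j \<in> J" for j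
    using deriv[OF that] by (meson DERIV_isCont continuous_at_imp_continuous_on)
  have "closed S"
    unfolding S_def
    by (intro closed_UN J(1) ballI continuous_on_closed_Collect_le continuous_intros cont) auto
  moreover have "S \<noteq> {}"
    using J(2) ab by (auto simp: S_def intro!: exI[of _ a] bexI[of _ i])
  moreover have bdd: "bdd_above S"
    by (auto simp: S_def intro!: bdd_aboveI[of _ b])
  ultimately have "Sup S \<in> S"
    by (intro closed_contains_Sup)
  define t where "t = Sup S"
  obtain k where k: "k \<in> J" "t \<in> {a..b}" "f i a + c * (t - a) \<le> f k t"
    using \<open>Sup S \<in> S\<close> by (auto simp: S_def t_def)
  have "t = b"
  proof (rule ccontr)
    assume "t \<noteq> b"
    then have "t < b" using k by auto
    obtain j where j: "j \<in> J" "\<And>k. k \<in> J \<Longrightarrow> f k t \<le> f j t"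
      using obtains_maximizer[of J "\<lambda>j. f j t"] J by blast
    \<comment> \<open>Subtracting the line makes the derivative strictly positive, hence
      \<open>f j\<close> stays above the line slightly beyond \<open>t\<close>.\<close>
    have "((\<lambda>x. f j x - c * x) has_real_derivative D j t - c) (at t)"
      using deriv[OF j(1) k(2)] by (auto intro!: derivative_eq_intros)
    moreover have "0 < D j t - c"
      using D[OF j(1) k(2) j(2)] by simp
    ultimately obtain d where d: "0 < d"
      "\<And>e. 0 < e \<Longrightarrow> e < d \<Longrightarrow> f j t - c * t < f j (t + e) - c * (t + e)"
      by (blast dest: DERIV_pos_inc_right)
    define e where "e = min (d / 2) (b - t)"
    have e: "0 < e" "e < d" "t + e \<le> b"
      using d(1) \<open>t < b\<close> by (auto simp: e_def)
    have "f i a + c * (t + e - a) \<le> f j (t + e)"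
      using d(2)[OF e(1,2)] k(3) j(2)[OF k(1)] by (simp add: algebra_simps)
    then have "t + e \<in> S"
      using j(1) k(2) e by (auto simp: S_def)
    then have "t + e \<le> t"
      unfolding t_def by (rule cSup_upper[OF _ bdd])
    with e show False by simp
  qed
  with k show ?thesis by auto
qed

text \<open>Apply the strict version with slope \<open>c - e\<close> and let \<open>e\<close> tend
  to 0.\<close>

lemma maximum_grows:
  fixes f D :: "'a \<Rightarrow> real \<Rightarrow> real"
  assumes J: "finite J" "i \<in> J" and ab: "a \<le> b"
    and deriv: "\<And>j t. j \<in> J \<Longrightarrow> t \<in> {a..b} \<Longrightarrow> (f j has_real_derivative D j t) (at t)"
    and D: "\<And>j t. j \<in> J \<Longrightarrow> t \<in> {a..b} \<Longrightarrow> (\<And>k. k \<in> J \<Longrightarrow> f k t \<le> f j t) \<Longrightarrow> c \<le> D j t"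
  shows "\<exists>j\<in>J. f i a + c * (b - a) \<le> f j b"
proof -
  \<comment> \<open>The index is fixed as a maximizer at \<open>b\<close>, independent of
    \<open>e\<close>, so the limit can be taken in one inequality.\<close>
  obtain j where j: "j \<in> J" "\<And>k. k \<in> J \<Longrightarrow> f k b \<le> f j b"
    using obtains_maximizer[of J "\<lambda>j. f j b"] J by blast
  have "f i a + (c - e) * (b - a) \<le> f j b" if "e > 0" for e
  proof -
    have "\<exists>k\<in>J. f i a + (c - e) * (b - a) \<le> f k b"
    proof (rule maximum_grows_strict[OF J ab deriv])
      fix k t assume "k \<in> J" "t \<in> {a..b}" "\<And>l. l \<in> J \<Longrightarrow> f l t \<le> f k t"
      then show "c - e < D k t" using D[of k t] that by force
    qed
    then show ?thesis using j(2) by force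
  qed
  then have "\<forall>\<^sub>F e in at_right 0. f i a + (c - e) * (b - a) \<le> f j b"
    by (auto simp: eventually_at_filter)
  moreover have "((\<lambda>e. f i a + (c - e) * (b - a)) \<longlongrightarrow> f i a + (c - 0) * (b - a)) (at_right 0)"
    by (intro tendsto_intros)
  ultimately have "f i a + (c - 0) * (b - a) \<le> f j b"
    by (intro tendsto_upperbound) auto
  with j(1) show ?thesis by auto
qed

text \<open>Time reversal: for \<open>f j (- t)\<close> on \<open>[-b, -a]\<close> the slopes change
  sign, and the upper bound becomes a lower one.\<close>

lemma maximum_grows_at_most:
  fixes f D :: "'a \<Rightarrow> real \<Rightarrow> real"
  assumes J: "finite J" "i \<in> J" and ab: "a \<le> b"
    and deriv: "\<And>j t. j \<in> J \<Longrightarrow> t \<in> {a..b} \<Longrightarrow> (f j has_real_derivative D j t) (at t)"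
    and D: "\<And>j t. j \<in> J \<Longrightarrow> t \<in> {a..b} \<Longrightarrow> (\<And>k. k \<in> J \<Longrightarrow> f k t \<le> f j t) \<Longrightarrow> D j t \<le> c"
  shows "\<exists>j\<in>J. f i b \<le> f j a + c * (b - a)"
proof -
  have "\<exists>j\<in>J. f i (- (- b)) + (- c) * ((- a) - (- b)) \<le> f j (- (- a))"
  proof (rule maximum_grows[OF J, where f = "\<lambda>j t. f j (- t)" and D = "\<lambda>j t. - D j (- t)"])
    fix j t assume "j \<in> J" and t: "t \<in> {- b..- a}"
    have "(f j has_real_derivative D j (- t)) (at (- t))"
      using t by (intro deriv \<open>j \<in> J\<close>) auto
    from DERIV_chain2[where f = "f j" and g = uminus and x = t, OF this DERIV_minus[OF DERIV_ident]]
    show "((\<lambda>t. f j (- t)) has_real_derivative - D j (- t)) (at t)"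
      by simp
  next
    fix j t assume "j \<in> J" "t \<in> {- b..- a}" "\<And>k. k \<in> J \<Longrightarrow> f k (- t) \<le> f j (- t)"
    then show "- c \<le> - D j (- t)" using D[of j "- t"] by auto
  qed (use ab in auto)
  then show ?thesis by (auto simp: algebra_simps)
qed

section \<open>The maximum raised to the power \<open>1 - p\<close>\<close>

lemma DERIV_neg_powr_1_minus:
  fixes u :: "real \<Rightarrow> real"
  assumes "(u has_real_derivative d) (at t)" "0 < u t"
  shows "((\<lambda>s. - (u s powr (1 - p))) has_real_derivative (p - 1) * (d / u t powr p)) (at t)"
proof -
  \<comment> \<open>The chain rule leaves the exponent \<open>-p\<close>, so a bound of
    \<open>d\<close> by a multiple of \<open>u t powr p\<close> becomes a bound on the slope by a
    constant.\<close>
  have "u t powr (1 - p - 1) = 1 / u t powr p"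
    by (simp add: powr_minus_divide)
  then have "- ((1 - p) * u t powr (1 - p - 1) * d) = (p - 1) * (d / u t powr p)"
    by (simp add: algebra_simps diff_divide_distrib)
  with DERIV_minus[OF DERIV_fun_powr[OF assms, of "1 - p"]] show ?thesis by simp
qed

context
  fixes J :: "'a set" and u u' :: "real \<Rightarrow> 'a \<Rightarrow> real" and a b p :: real
  assumes J: "finite J" "J \<noteq> {}" and ab: "a \<le> b" and p: "1 < p"
    and pos: "\<And>j t. j \<in> J \<Longrightarrow> t \<in> {a..b} \<Longrightarrow> 0 < u t j"
    and deriv: "\<And>j t. j \<in> J \<Longrightarrow> t \<in> {a..b} \<Longrightarrow> ((\<lambda>s. u s j) has_real_derivative u' t j) (at t)"
begin

text \<open>The minus sign makes the transformation increasing on positive values, so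
  \<open>u\<close> and its transform have the same maximizers and the growth lemmas apply to the
  latter.\<close>

lemma powr_neg_le_iff:
  assumes "j \<in> J" "k \<in> J" "t \<in> {a..b}"
  shows "- (u t k powr (1 - p)) \<le> - (u t j powr (1 - p)) \<longleftrightarrow> u t k \<le> u t j"
proof -
  have *: "x powr (1 - p) < y powr (1 - p)" if "0 < y" "y < x" for x y
    using that p by (intro powr_less_mono2_neg) auto
  show ?thesis
    using *[of "u t j" "u t k"] *[of "u t k" "u t j"] pos[of j t] pos[of k t] assms
    by (cases "u t k" "u t j" rule: linorder_cases) auto
qed

lemma Max_powr_le:
  assumes "j \<in> J" "t \<in> {a..b}"
  shows "Max (u t ` J) powr (1 - p) \<le> u t j powr (1 - p)"
proof -
  have "u t j \<le> Max (u t ` J)" using assms J by auto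
  then show ?thesis using pos[OF assms] p by (intro powr_mono2') auto
qed

text \<open>Integrated form of M' \<ge> c M^p: at every maximizer the transform has slope at least
  \<open>(p - 1) * c\<close>.\<close>

lemma Max_powr_decreases:
  assumes D: "\<And>j t. j \<in> J \<Longrightarrow> t \<in> {a..b} \<Longrightarrow> (\<And>k. k \<in> J \<Longrightarrow> u t k \<le> u t j) \<Longrightarrow>
      c * u t j powr p \<le> u' t j"
  shows "Max (u b ` J) powr (1 - p) \<le> Max (u a ` J) powr (1 - p) - (p - 1) * c * (b - a)"
proof -
  obtain i where i: "i \<in> J" "Max (u a ` J) = u a i"
    using obtains_maximizer[OF J, of "u a"] by blast
  have "\<exists>j\<in>J. - (u a i powr (1 - p)) + ((p - 1) * c) * (b - a) \<le> - (u b j powr (1 - p))"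
  proof (rule maximum_grows[OF J(1) i(1) ab DERIV_neg_powr_1_minus[OF deriv pos]])
    fix j t assume jt: "j \<in> J" "t \<in> {a..b}"
      and *: "\<And>k. k \<in> J \<Longrightarrow> - (u t k powr (1 - p)) \<le> - (u t j powr (1 - p))"
    have "u t k \<le> u t j" if "k \<in> J" for k
      using powr_neg_le_iff[OF jt(1) that jt(2)] *[OF that] by blast
    then have "c * u t j powr p \<le> u' t j"
      by (rule D[OF jt])
    then have "c \<le> u' t j / u t j powr p"
      using pos[OF jt] by (simp add: pos_le_divide_eq)
    then show "(p - 1) * c \<le> (p - 1) * (u' t j / u t j powr p)"
      using p by (intro mult_left_mono) auto
  qed auto
  then obtain j where "j \<in> J" "u b j powr (1 - p) \<le> u a i powr (1 - p) - (p - 1) * c * (b - a)"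
    by (auto simp: algebra_simps)
  \<comment> \<open>The growth lemma yields only some index at \<open>b\<close>; passing to the
    maximum is harmless since the power \<open>1 - p\<close> is decreasing.\<close>
  with Max_powr_le[of j b] i ab show ?thesis by auto
qed

text \<open>Integrated form of M' \<le> c M^p, starting from a maximizer at \<open>b\<close> instead
  of \<open>a\<close>.\<close>

lemma Max_powr_decreases_at_most:
  assumes D: "\<And>j t. j \<in> J \<Longrightarrow> t \<in> {a..b} \<Longrightarrow> (\<And>k. k \<in> J \<Longrightarrow> u t k \<le> u t j) \<Longrightarrow>
      u' t j \<le> c * u t j powr p"
  shows "Max (u a ` J) powr (1 - p) - (p - 1) * c * (b - a) \<le> Max (u b ` J) powr (1 - p)"
proof -
  obtain i where i: "i \<in> J" "Max (u b ` J) = u b i"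
    using obtains_maximizer[OF J, of "u b"] by blast
  have "\<exists>j\<in>J. - (u b i powr (1 - p)) \<le> - (u a j powr (1 - p)) + ((p - 1) * c) * (b - a)"
  proof (rule maximum_grows_at_most[OF J(1) i(1) ab DERIV_neg_powr_1_minus[OF deriv pos]])
    fix j t assume jt: "j \<in> J" "t \<in> {a..b}"
      and *: "\<And>k. k \<in> J \<Longrightarrow> - (u t k powr (1 - p)) \<le> - (u t j powr (1 - p))"
    have "u t k \<le> u t j" if "k \<in> J" for k
      using powr_neg_le_iff[OF jt(1) that jt(2)] *[OF that] by blast
    then have "u' t j \<le> c * u t j powr p"
      by (rule D[OF jt])
    then have "u' t j / u t j powr p \<le> c"
      using pos[OF jt] by (simp add: pos_divide_le_eq)
    then show "(p - 1) * (u' t j / u t j powr p) \<le> (p - 1) * c"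
      using p by (intro mult_left_mono) auto
  qed auto
  then obtain j where "j \<in> J" "u a j powr (1 - p) - (p - 1) * c * (b - a) \<le> u b i powr (1 - p)"
    by (auto simp: algebra_simps)
  with Max_powr_le[of j a] i ab show ?thesis by auto
qed

end

section \<open>Estimates for real powers\<close>

lemma powr_absorbs_lower_order:
  fixes A B p q :: real
  assumes "1 < p" "q < p"
  shows "\<forall>\<^sub>F x in at_top. A * x + B * x powr q \<le> x powr p / 2"
proof -
  \<comment> \<open>After division by \<open>x powr p\<close> both exponents are negative.\<close>
  have "((\<lambda>x. A * x powr (1 - p) + B * x powr (q - p)) \<longlongrightarrow> A * 0 + B * 0) at_top"
    using assms by (intro tendsto_intros tendsto_neg_powr filterlim_ident) auto
  then have "\<forall>\<^sub>F x in at_top. A * x powr (1 - p) + B * x powr (q - p) < 1 / 2"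
    by (rule order_tendstoD) auto
  with eventually_gt_at_top[of 0] show ?thesis
  proof eventually_elim
    case (elim x)
    have "(A * x powr (1 - p) + B * x powr (q - p)) * x powr p \<le> (1 / 2) * x powr p"
      using elim by (intro mult_right_mono) auto
    then show ?case
      using elim by (simp add: algebra_simps flip: powr_add)
  qed
qed

text \<open>The exponent \<open>- 1 / (p - 1)\<close> inverts the power \<open>1 - p\<close>; being
  negative, it reverses the inequality.\<close>

lemma powr_le_powr_neg_inverse:
  fixes x y p :: real
  assumes "1 < p" "0 < x" "0 < y" "y \<le> x powr (1 - p)"
  shows "x \<le> y powr (- 1 / (p - 1))"
proof -
  have "(x powr (1 - p)) powr (- 1 / (p - 1)) \<le> y powr (- 1 / (p - 1))"
    using assms by (intro powr_mono2') (auto simp: divide_le_0_iff)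
  moreover have "(1 - p) * (- 1 / (p - 1)) = 1"
    using assms by (simp add: field_simps)
  ultimately show ?thesis using assms by (simp add: powr_powr)
qed

lemma powr_neg_inverse_le:
  fixes x y p :: real
  assumes "1 < p" "0 < x" "0 < y" "x powr (1 - p) \<le> y"
  shows "y powr (- 1 / (p - 1)) \<le> x"
proof -
  have "y powr (- 1 / (p - 1)) \<le> (x powr (1 - p)) powr (- 1 / (p - 1))"
    using assms by (intro powr_mono2') (auto simp: divide_le_0_iff)
  moreover have "(1 - p) * (- 1 / (p - 1)) = 1"
    using assms by (simp add: field_simps)
  ultimately show ?thesis using assms by (simp add: powr_powr)
qed

section \<open>Blow-up rates on a fixed mesh\<close>

lemma semidiscrete_bound_up_to:
  assumes sol: "semidiscrete_solution p q h \<beta> u0 T u" and "t0 < T"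
  shows "\<exists>L. \<forall>t\<in>{0..t0}. \<forall>j\<in>{1..mesh_N h}. u t j \<le> L"
proof -
  have "\<exists>L. \<forall>t\<in>{0..t0}. u t j \<le> L" if "j \<in> {1..mesh_N h}" for j
  proof -
    have "continuous_on {0..<T} (\<lambda>t. u t j)"
      using sol that unfolding semidiscrete_solution_def continuous_on_eq_continuous_within
      by (blast intro: DERIV_continuous)
    then have "continuous_on {0..t0} (\<lambda>t. u t j)"
      by (rule continuous_on_subset) (use \<open>t0 < T\<close> in auto)
    then have "bdd_above ((\<lambda>t. u t j) ` {0..t0})"
      by (intro bounded_imp_bdd_above compact_imp_bounded compact_continuous_image) auto
    then show ?thesis by (auto simp: bdd_above_def)
  qed
  then obtain L where L: "\<And>j t. j \<in> {1..mesh_N h} \<Longrightarrow> t \<in> {0..t0} \<Longrightarrow> u t j \<le> L j"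
    by metis
  have "u t j \<le> Max (L ` {1..mesh_N h})" if "t \<in> {0..t0}" "j \<in> {1..mesh_N h}" for t j
    using L[OF that(2,1)] that by (intro order_trans[OF _ Max_ge[of _ "L j"]]) auto
  then show ?thesis by blast
qed

lemma semidiscrete_blowup_rate:
  fixes p q h T B :: real
  assumes p: "1 < p" and q: "0 \<le> q" "q < p" and h: "0 < h" and T: "0 < T"
    and \<beta>: "\<And>j. j \<in> {1..mesh_N h} \<Longrightarrow> 0 < \<beta> j \<and> \<beta> j \<le> B"
    and sol: "semidiscrete_solution p q h \<beta> u0 T u"
    and posu: "positive_on h T u" and blowup: "blows_up_at h T u"
  shows "\<exists>C1>0. \<exists>C2>0. \<forall>t\<in>{0<..<T}.
     C1 * (T - t) powr (- 1 / (p - 1)) \<le> Max (u t ` {1..mesh_N h}) \<and>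
     Max (u t ` {1..mesh_N h}) \<le> C2 * (T - t) powr (- 1 / (p - 1))"
proof -
  define J where "J = {1..mesh_N h}"
  define M where "M t = Max (u t ` J)" for t
  define u' where "u' t j = second_diff h (u t) j
      - \<beta> j * \<bar>central_diff h (u t) j\<bar> powr q + \<bar>u t j\<bar> powr p" for t j
  have J: "finite J" "J \<noteq> {}" by (auto simp: J_def mesh_N_def)
  have pos: "0 < u t j" if "j \<in> J" "t \<in> {0<..<T}" for t j
    using posu that by (auto simp: positive_on_def J_def)
  have deriv: "((\<lambda>s. u s j) has_real_derivative u' t j) (at t)"
    if "j \<in> J" "t \<in> {0<..<T}" for j t
  proof -
    have "((\<lambda>s. u s j) has_real_derivative u' t j) (at t within {0..<T})"
      using sol that by (auto simp: semidiscrete_solution_def J_def u'_def)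
    then have "((\<lambda>s. u s j) has_real_derivative u' t j) (at t within {0<..<T})"
      by (rule DERIV_subset) auto
    moreover have "at t within {0<..<T} = at t"
      using that(2) by (rule at_within_open) simp
    ultimately show ?thesis by (simp only:)
  qed
  have boundary: "u t 0 = 0" "u t (mesh_N h + 1) = 0" if "t \<in> {0<..<T}" for t
    using sol that by (auto simp: semidiscrete_solution_def)
  have M_ge: "u t j \<le> M t" if "j \<in> J" for t j
    using J that by (auto simp: M_def)
  have M_pos: "0 < M t" if "t \<in> {0<..<T}" for t
    using J pos[OF _ that] by (auto simp: M_def Max_gr_iff)
  \<comment> \<open>The two boundary nodes are included because they are neighbours of the first and
    last interior nodes.\<close>
  have grid: "0 \<le> u t k \<and> u t k \<le> M t" if "k \<le> mesh_N h + 1" "t \<in> {0<..<T}" for t k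
  proof (cases "k \<in> J")
    case True
    then show ?thesis using pos[of k t] M_ge[of k t] that by auto
  next
    case False
    then have "k = 0 \<or> k = mesh_N h + 1" using that by (auto simp: J_def)
    then show ?thesis using boundary[OF that(2)] M_pos[OF that(2)] by auto
  qed
  \<comment> \<open>The factor 1 is the constant \<open>c\<close> expected by
    \<open>Max_powr_decreases_at_most\<close>.\<close>
  have at_max: "u' t j \<le> 1 * u t j powr p"
    "u t j powr p - (2 / h\<^sup>2 * M t + B * (1 / (2 * h)) powr q * M t powr q) \<le> u' t j"
    if j: "j \<in> J" and t: "t \<in> {0<..<T}" and max: "\<And>k. k \<in> J \<Longrightarrow> u t k \<le> u t j" for t j
  proof -
    have Mj: "M t = u t j"
      using J j max by (auto simp: M_def intro!: Max_eqI)
    have nb: "0 \<le> u t (j + 1)" "u t (j + 1) \<le> M t" "0 \<le> u t (j - 1)" "u t (j - 1) \<le> M t"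
      using grid[of "j + 1" t] grid[of "j - 1" t] j t by (auto simp: J_def)
    have b: "0 < \<beta> j" "\<beta> j \<le> B" using \<beta> j by (auto simp: J_def)
    have abs: "\<bar>u t j\<bar> = u t j" using pos[OF j t] by simp
    have "second_diff h (u t) j \<le> 0"
      unfolding second_diff_def using nb Mj by (intro divide_nonpos_nonneg) auto
    moreover have "0 \<le> \<beta> j * \<bar>central_diff h (u t) j\<bar> powr q"
      using b by auto
    ultimately show "u' t j \<le> 1 * u t j powr p"
      by (simp add: u'_def abs)
    have "(- (2 * M t)) / h\<^sup>2 \<le> second_diff h (u t) j"
      unfolding second_diff_def using nb Mj by (intro divide_right_mono) auto
    moreover have "\<beta> j * \<bar>central_diff h (u t) j\<bar> powr q \<le> B * (1 / (2 * h) * M t) powr q"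
    proof (intro mult_mono powr_mono2)
      \<comment> \<open>Both neighbours lie in \<open>[0, M t]\<close>, so their difference is at
        most \<open>M t\<close>.\<close>
      have "\<bar>u t (j + 1) - u t (j - 1)\<bar> \<le> M t" using nb by linarith
      then show "\<bar>central_diff h (u t) j\<bar> \<le> 1 / (2 * h) * M t"
        unfolding central_diff_def using h by (simp add: abs_divide divide_right_mono)
    qed (use b q in auto)
    moreover have "(1 / (2 * h) * M t) powr q = (1 / (2 * h)) powr q * M t powr q"
      by (rule powr_mult)
    ultimately show
      "u t j powr p - (2 / h\<^sup>2 * M t + B * (1 / (2 * h)) powr q * M t powr q) \<le> u' t j"
      by (simp add: u'_def abs)
  qed
  have ev_interior: "\<forall>\<^sub>F t in at_left T. t \<in> {s<..<T}" if "s < T" for s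
    using eventually_at_left_real[OF that] .
  \<comment> \<open>Blow-up of the norm passes to \<open>M\<close>, since all nodal values are
    nonnegative and the boundary ones vanish.\<close>
  have M_lim: "filterlim M at_top (at_left T)"
  proof (rule filterlim_at_top_mono)
    show "filterlim (\<lambda>t. grid_norm h (u t)) at_top (at_left T)"
      using blowup by (simp add: blows_up_at_def)
    show "\<forall>\<^sub>F t in at_left T. grid_norm h (u t) \<le> M t"
      using ev_interior[OF T]
    proof eventually_elim
      case (elim t)
      then show ?case
        unfolding grid_norm_def using grid[OF _ elim] by (subst Max_le_iff) auto
    qed
  qed
  have M_powr_lim: "((\<lambda>t. M t powr (1 - p)) \<longlongrightarrow> 0) (at_left T)"
    using p by (intro tendsto_neg_powr M_lim) auto
  define r where "r = - 1 / (p - 1)"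
  have lower: "(p - 1) powr r * (T - s) powr r \<le> M s" if s: "s \<in> {0<..<T}" for s
  proof -
    \<comment> \<open>Integrate from \<open>s\<close> to \<open>t\<close> and let \<open>t\<close>
      tend to \<open>T\<close>, where the right side vanishes. This bounds
      \<open>M s powr (1 - p)\<close> by \<open>(p - 1) * (T - s)\<close>.\<close>
    have "\<forall>\<^sub>F t in at_left T. M s powr (1 - p) - (p - 1) * 1 * (t - s) \<le> M t powr (1 - p)"
      using ev_interior[of s]
    proof (rule eventually_mono)
      fix t assume t: "t \<in> {s<..<T}"
      show "M s powr (1 - p) - (p - 1) * 1 * (t - s) \<le> M t powr (1 - p)"
        unfolding M_def
        using s t by (intro Max_powr_decreases_at_most[OF J _ p pos deriv] at_max(1)) auto
    qed (use s in auto)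
    moreover have "((\<lambda>t. M s powr (1 - p) - (p - 1) * 1 * (t - s)) \<longlongrightarrow>
        M s powr (1 - p) - (p - 1) * 1 * (T - s)) (at_left T)"
      by (intro tendsto_intros)
    ultimately have "M s powr (1 - p) - (p - 1) * 1 * (T - s) \<le> 0"
      by (intro tendsto_le[OF _ M_powr_lim]) auto
    then have "((p - 1) * (T - s)) powr r \<le> M s"
      unfolding r_def using s p M_pos[OF s] by (intro powr_neg_inverse_le) auto
    then show ?thesis using s p by (simp add: powr_mult)
  qed
  have "\<forall>\<^sub>F t in at_left T. 2 / h\<^sup>2 * M t + B * (1 / (2 * h)) powr q * M t powr q \<le> M t powr p / 2"
    using powr_absorbs_lower_order[OF p q(2)] M_lim by (rule eventually_compose_filterlim)
  then obtain t1 where t1: "t1 < T"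
    "\<And>t. t1 < t \<Longrightarrow> t < T \<Longrightarrow>
       2 / h\<^sup>2 * M t + B * (1 / (2 * h)) powr q * M t powr q \<le> M t powr p / 2"
    unfolding eventually_at_left_field by blast
  \<comment> \<open>The time \<open>t1\<close> may be negative, whereas the solution starts at
    0.\<close>
  define t0 where "t0 = max t1 0"
  have t0: "t0 < T" "0 \<le> t0" "t1 \<le> t0" using t1 T by (auto simp: t0_def)
  have upper: "M s \<le> ((p - 1) / 2) powr r * (T - s) powr r" if s: "s \<in> {t0<..<T}" for s
  proof -
    \<comment> \<open>The constant 1/2 is the share of \<open>M t powr p\<close> that remains after
      absorption, which is available from \<open>t0\<close> on.\<close>
    have "\<forall>\<^sub>F t in at_left T. M t powr (1 - p) \<le> M s powr (1 - p) - (p - 1) * (1 / 2) * (t - s)"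
      using ev_interior[of s]
    proof (rule eventually_mono)
      fix t assume t: "t \<in> {s<..<T}"
      show "M t powr (1 - p) \<le> M s powr (1 - p) - (p - 1) * (1 / 2) * (t - s)"
        unfolding M_def
      proof (rule Max_powr_decreases[OF J _ p pos deriv])
        fix j \<tau> assume *: "j \<in> J" "\<tau> \<in> {s..t}" "\<And>k. k \<in> J \<Longrightarrow> u \<tau> k \<le> u \<tau> j"
        then have "M \<tau> = u \<tau> j"
          using J by (auto simp: M_def intro!: Max_eqI)
        then show "1 / 2 * u \<tau> j powr p \<le> u' \<tau> j"
          using at_max(2)[of j \<tau>] t1(2)[of \<tau>] * s t t0 by auto
      qed (use s t t0 in auto)
    qed (use s in auto)
    moreover have "((\<lambda>t. M s powr (1 - p) - (p - 1) * (1 / 2) * (t - s)) \<longlongrightarrow>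
        M s powr (1 - p) - (p - 1) * (1 / 2) * (T - s)) (at_left T)"
      by (intro tendsto_intros)
    ultimately have "0 \<le> M s powr (1 - p) - (p - 1) * (1 / 2) * (T - s)"
      by (intro tendsto_le[OF _ _ M_powr_lim]) auto
    then have "M s \<le> ((p - 1) / 2 * (T - s)) powr r"
      unfolding r_def using s t0 p M_pos[of s] by (intro powr_le_powr_neg_inverse) auto
    then show ?thesis by (simp only: powr_mult)
  qed
  obtain L where L: "\<And>t j. t \<in> {0..t0} \<Longrightarrow> j \<in> J \<Longrightarrow> u t j \<le> L"
    using semidiscrete_bound_up_to[OF sol t0(1)] unfolding J_def by blast
  \<comment> \<open>The first summand serves times after \<open>t0\<close>. The second serves
    earlier ones, where \<open>M\<close> is at most \<open>L\<close> and
    \<open>(T - s) powr r\<close> is at least \<open>T powr r\<close> because \<open>r\<close> is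
    negative.\<close>
  define C2 where "C2 = ((p - 1) / 2) powr r + \<bar>L\<bar> / T powr r"
  have C2: "0 < C2" using p by (auto simp: C2_def intro!: add_pos_nonneg)
  have "M s \<le> C2 * (T - s) powr r" if s: "s \<in> {0<..<T}" for s
  proof (cases "t0 < s")
    case True
    then have "M s \<le> ((p - 1) / 2) powr r * (T - s) powr r" using s by (intro upper) auto
    also have "\<dots> \<le> C2 * (T - s) powr r"
      by (intro mult_right_mono) (auto simp: C2_def)
    finally show ?thesis .
  next
    case False
    have "M s \<le> L" using s False J L[of s] by (auto simp: M_def)
    also have "L \<le> \<bar>L\<bar> / T powr r * T powr r" using T by simp
    also have "\<dots> \<le> C2 * (T - s) powr r"
      using s p by (intro mult_mono powr_mono2') (auto simp: C2_def r_def divide_le_0_iff)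
    finally show ?thesis .
  qed
  moreover have "0 < (p - 1) powr r" using p by simp
  ultimately show ?thesis
    using lower C2 unfolding M_def J_def r_def by blast
qed

theorem theorem5p1:
  fixes p q :: real and b :: "real \<Rightarrow> real"
  assumes "p > 1" and "1 < q" and "q \<le> 2 * p / (p + 1)"
    and "continuous_on UNIV b" and "\<forall>x. 0 < b x" and "bounded (range b)"
    and "q = 2 * p / (p + 1) \<Longrightarrow>
           0 < sup_norm b \<and> sup_norm b < (p - 1) / 2 * (2 / (p + 1)) powr (1 / (p + 1))"
  shows "\<exists>K>0. \<exists>H>0. \<forall>h0 h \<beta> u0 u T Th.
      0 < h0 \<and> h0 \<le> H \<and> 0 < h \<and>
      approx_coeff b h \<beta> \<and>
      (\<forall>j\<in>{1..mesh_N h}. 0 \<le> u0 j) \<and>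
      0 < T \<and> maximal_solution p q h \<beta> u0 T u \<and> positive_on h T u \<and>
      blows_up_at h T u \<and>
      0 \<le> Th \<and> Th < T \<and> mesh_convention q (sup_norm b) h0 h Th u \<and>
      (q < 2 * p / (p + 1) \<longrightarrow> K \<le> grid_norm h (u 0)) \<longrightarrow>
      (\<exists>C1>0. \<exists>C2>0. \<forall>t\<in>{0<..<T}.
         C1 * (T - t) powr (- 1 / (p - 1)) \<le> Max ((\<lambda>j. u t j) ` {1..mesh_N h}) \<and>
         Max ((\<lambda>j. u t j) ` {1..mesh_N h}) \<le> C2 * (T - t) powr (- 1 / (p - 1)))"
proof -
  have "2 * p / (p + 1) < p"
    using \<open>p > 1\<close> by (simp add: field_simps)
  then have "q < p" using \<open>q \<le> 2 * p / (p + 1)\<close> by simp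
  show ?thesis
  \<comment> \<open>Default values: any positive \<open>K\<close> and \<open>H\<close> serve, as
    \<open>C1\<close> and \<open>C2\<close> are chosen after the mesh and the solution.\<close>
  proof (rule exI[of _ 1], rule conjI[OF zero_less_one], rule exI[of _ 1],
      rule conjI[OF zero_less_one], intro allI impI, elim conjE)
    fix h0 h :: real and \<beta> u0 u T Th
    assume "0 < h" "0 < T" "approx_coeff b h \<beta>" "maximal_solution p q h \<beta> u0 T u"
      "positive_on h T u" "blows_up_at h T u"
    then show "\<exists>C1>0. \<exists>C2>0. \<forall>t\<in>{0<..<T}.
         C1 * (T - t) powr (- 1 / (p - 1)) \<le> Max ((\<lambda>j. u t j) ` {1..mesh_N h}) \<and>
         Max ((\<lambda>j. u t j) ` {1..mesh_N h}) \<le> C2 * (T - t) powr (- 1 / (p - 1))"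
      using \<open>p > 1\<close> \<open>1 < q\<close> \<open>q < p\<close>
      by (intro semidiscrete_blowup_rate[where \<beta> = \<beta> and B = "sup_norm b"])
        (auto simp: approx_coeff_def maximal_solution_def)
  qed
qed

end
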